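(* There exist infinitely many pairs of matrices $A,B\in SL(2,\mathbb{Z})$ which are conjugate in every congruence quotient of $SL(2,\mathbb{Z})$, such that $A$ is conjugate neither to $B$ nor to $B^{-1}$ in $GL(2,\mathbb{Z})$. For instance one can take $$A=\begin{pmatrix}1 & kq^2\\ kv & 1+k^2q^2v\end{pmatrix},\qquad B=\begin{pmatrix}1 & k\\ kvq^2 & 1+k^2q^2v\end{pmatrix},$$ where $k\in\mathbb{Z}$, $k\neq 0$, $q$ is an odd prime with $q\equiv 1\pmod 4$, and $v$ is a positive integer such that $-v$ is a non-zero quadratic residue mod $q$ and $v$ is divisible either by a prime $p\equiv 3\pmod 4$, or by $4$.
   Context: A congruence quotient of $SL(2,\mathbb{Z})$ is $SL(2,\mathbb{Z}/m\mathbb{Z})$ for a non-zero integer $m$; $A$ and $B$ are conjugate in it if their reductions mod $m$ are conjugate in $SL(2,\mathbb{Z}/m\mathbb{Z})$. *)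

theory Defs
  imports
    "HOL-Analysis.Determinants"
    "HOL-Algebra.IntRing"
    "HOL-Number_Theory.Residues"
begin

text \<open>
  The monoid of 2 by 2 matrices over a ring \<open>R\<close>, so that one definition of
  \<open>GL(2, R)\<close> and \<open>SL(2, R)\<close> serves both \<open>R = \<Z>\<close> and
  \<open>R = \<Z>/m\<Z>\<close>, which is \<^term>\<open>ZFact m\<close>.
\<close>

definition mat2 :: "('a, 'r) ring_scheme \<Rightarrow> ('a^2^2) monoid" where
  "mat2 R =
    \<lparr>carrier = {M. \<forall>i j. M $ i $ j \<in> carrier R},
     mult = (\<lambda>M N. \<chi> i j.
       M $ i $ 1 \<otimes>\<^bsub>R\<^esub> N $ 1 $ j \<oplus>\<^bsub>R\<^esub> M $ i $ 2 \<otimes>\<^bsub>R\<^esub> N $ 2 $ j),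
     one = (\<chi> i j. if i = j then \<one>\<^bsub>R\<^esub> else \<zero>\<^bsub>R\<^esub>)\<rparr>"

definition det2 :: "('a, 'r) ring_scheme \<Rightarrow> 'a^2^2 \<Rightarrow> 'a" where
  "det2 R M = M $ 1 $ 1 \<otimes>\<^bsub>R\<^esub> M $ 2 $ 2 \<ominus>\<^bsub>R\<^esub> M $ 1 $ 2 \<otimes>\<^bsub>R\<^esub> M $ 2 $ 1"

definition GL2 :: "('a, 'r) ring_scheme \<Rightarrow> ('a^2^2) monoid" where
  "GL2 R = units_of (mat2 R)"

definition SL2 :: "('a, 'r) ring_scheme \<Rightarrow> ('a^2^2) monoid" where
  "SL2 R = (mat2 R)\<lparr>carrier := {M \<in> carrier (mat2 R). det2 R M = \<one>\<^bsub>R\<^esub>}\<rparr>"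

definition conjugate_in :: "('a, 'm) monoid_scheme \<Rightarrow> 'a \<Rightarrow> 'a \<Rightarrow> bool" where
  "conjugate_in G x y \<longleftrightarrow> (\<exists>g \<in> carrier G. y = g \<otimes>\<^bsub>G\<^esub> x \<otimes>\<^bsub>G\<^esub> inv\<^bsub>G\<^esub> g)"

text \<open>The entries of the reduction are the residue classes, i.e. cosets of \<open>m\<Z>\<close> in \<open>\<Z>\<close>.\<close>

definition reduce_mod :: "int \<Rightarrow> int^2^2 \<Rightarrow> (int set)^2^2" where
  "reduce_mod m A = (\<chi> i j. Idl\<^bsub>\<Z>\<^esub> {m} +>\<^bsub>\<Z>\<^esub> A $ i $ j)"

definition conjugate_in_congruence_quotients :: "int^2^2 \<Rightarrow> int^2^2 \<Rightarrow> bool" where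
  "conjugate_in_congruence_quotients A B \<longleftrightarrow>
    (\<forall>m. m \<noteq> 0 \<longrightarrow> conjugate_in (SL2 (ZFact m)) (reduce_mod m A) (reduce_mod m B))"

definition good_pair :: "int^2^2 \<Rightarrow> int^2^2 \<Rightarrow> bool" where
  "good_pair A B \<longleftrightarrow>
    A \<in> carrier (SL2 \<Z>) \<and> B \<in> carrier (SL2 \<Z>) \<and>
    conjugate_in_congruence_quotients A B \<and>
    \<not> conjugate_in (GL2 \<Z>) A B \<and>
    \<not> conjugate_in (GL2 \<Z>) A (inv\<^bsub>GL2 \<Z>\<^esub> B)"


text \<open>Over the integers these notions agree with those of \<^theory>\<open>HOL-Analysis.Determinants\<close>.\<close>

lemma mat2_int:
  "carrier (mat2 \<Z>) = UNIV" "mult (mat2 \<Z>) = (**)" "one (mat2 \<Z>) = mat 1"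
  by (auto simp: mat2_def fun_eq_iff vec_eq_iff matrix_matrix_mult_def sum_2 mat_def)

lemma det2_int: "det2 \<Z> A = det A"
proof -
  have "x \<ominus>\<^bsub>\<Z>\<^esub> y = x - y" for x y
    by (rule int_a_minus_eq)
  then show ?thesis
    by (simp add: det2_def det_2)
qed

lemma carrier_SL2_int: "carrier (SL2 \<Z>) = {A. det A = 1}"
  by (simp add: SL2_def det2_int mat2_int)

lemma carrier_GL2_int: "carrier (GL2 \<Z>) = {A. invertible A}"
  by (auto simp: GL2_def units_of_carrier Units_def mat2_int invertible_def)


context cring
begin

lemma monoid_mat2: "monoid (mat2 R)"
proof (rule monoidI)
  fix L M N assume "L \<in> carrier (mat2 R)" "M \<in> carrier (mat2 R)" "N \<in> carrier (mat2 R)"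
  then have [simp]: "L $ i $ j \<in> carrier R" "M $ i $ j \<in> carrier R" "N $ i $ j \<in> carrier R" for i j
    by (auto simp: mat2_def)
  show "L \<otimes>\<^bsub>mat2 R\<^esub> M \<otimes>\<^bsub>mat2 R\<^esub> N = L \<otimes>\<^bsub>mat2 R\<^esub> (M \<otimes>\<^bsub>mat2 R\<^esub> N)"
    by (simp add: mat2_def vec_eq_iff, intro allI)
      (simp add: l_distr r_distr m_ac a_ac)
qed (auto simp: mat2_def vec_eq_iff forall_2)

lemma group_GL2: "group (GL2 R)"
  unfolding GL2_def by (rule monoid.units_group[OF monoid_mat2])

lemma det_mult_aux:
  assumes [simp]: "a \<in> carrier R" "b \<in> carrier R" "c \<in> carrier R" "d \<in> carrier R"
    "m \<in> carrier R" "n \<in> carrier R" "p \<in> carrier R" "q \<in> carrier R"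
  shows "(a \<otimes> m \<oplus> b \<otimes> p) \<otimes> (c \<otimes> n \<oplus> d \<otimes> q) \<ominus>
      (a \<otimes> n \<oplus> b \<otimes> q) \<otimes> (c \<otimes> m \<oplus> d \<otimes> p)
   = (a \<otimes> d \<ominus> b \<otimes> c) \<otimes> (m \<otimes> q \<ominus> n \<otimes> p)"
  using assms by Ring.algebra

lemma group_SL2: "group (SL2 R)"
proof (rule groupI)
  fix M N assume MN: "M \<in> carrier (SL2 R)" "N \<in> carrier (SL2 R)"
  then have [simp]: "M $ i $ j \<in> carrier R" "N $ i $ j \<in> carrier R" for i j
    by (auto simp: SL2_def mat2_def)
  have d: "det2 R M = \<one>" "det2 R N = \<one>"
    using MN by (auto simp: SL2_def)
  have "det2 R (M \<otimes>\<^bsub>mat2 R\<^esub> N) = det2 R M \<otimes> det2 R N"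
    by (simp add: det2_def mat2_def det_mult_aux)
  then show "M \<otimes>\<^bsub>SL2 R\<^esub> N \<in> carrier (SL2 R)"
    using d by (auto simp: SL2_def mat2_def)
next
  show "\<one>\<^bsub>SL2 R\<^esub> \<in> carrier (SL2 R)"
    by (auto simp: SL2_def mat2_def det2_def a_minus_def)
next
  fix L M N assume "L \<in> carrier (SL2 R)" "M \<in> carrier (SL2 R)" "N \<in> carrier (SL2 R)"
  then show "L \<otimes>\<^bsub>SL2 R\<^esub> M \<otimes>\<^bsub>SL2 R\<^esub> N = L \<otimes>\<^bsub>SL2 R\<^esub> (M \<otimes>\<^bsub>SL2 R\<^esub> N)"
    using monoid.m_assoc[OF monoid_mat2] by (simp add: SL2_def)
next
  fix M assume "M \<in> carrier (SL2 R)"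
  then show "\<one>\<^bsub>SL2 R\<^esub> \<otimes>\<^bsub>SL2 R\<^esub> M = M"
    using monoid.l_one[OF monoid_mat2] by (simp add: SL2_def)
next
  fix M assume M: "M \<in> carrier (SL2 R)"
  then have [simp]: "M $ i $ j \<in> carrier R" for i j
    by (auto simp: SL2_def mat2_def)
  have d: "M $ 1 $ 1 \<otimes> M $ 2 $ 2 \<oplus> \<ominus> (M $ 1 $ 2 \<otimes> M $ 2 $ 1) = \<one>"
    using M by (auto simp: SL2_def det2_def a_minus_def)
  have d': "M $ 2 $ 2 \<otimes> M $ 1 $ 1 \<oplus> \<ominus> (M $ 1 $ 2 \<otimes> M $ 2 $ 1) = \<one>"
    "\<ominus> (M $ 2 $ 1 \<otimes> M $ 1 $ 2) \<oplus> M $ 1 $ 1 \<otimes> M $ 2 $ 2 = \<one>"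
    using d by (simp_all add: m_comm a_comm)
  define N :: "'a^2^2" where
    "N = (\<chi> i j. if i = j then M $ (if i = 1 then 2 else 1) $ (if i = 1 then 2 else 1)
                 else \<ominus> (M $ i $ j))"
  have N: "N $ 1 $ 1 = M $ 2 $ 2" "N $ 1 $ 2 = \<ominus> (M $ 1 $ 2)"
    "N $ 2 $ 1 = \<ominus> (M $ 2 $ 1)" "N $ 2 $ 2 = M $ 1 $ 1"
    by (simp_all add: N_def)
  have "det2 R N = \<one>"
    by (simp add: det2_def N a_minus_def l_minus r_minus d')
  then have "N \<in> carrier (SL2 R)"
    by (simp add: SL2_def mat2_def N forall_2)
  moreover have "N \<otimes>\<^bsub>mat2 R\<^esub> M = \<one>\<^bsub>mat2 R\<^esub>"
    using m_comm[of "M $ 2 $ 2" "M $ 1 $ 2"] m_comm[of "M $ 2 $ 1" "M $ 1 $ 1"]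
    by (simp add: mat2_def vec_eq_iff forall_2 N l_minus d' r_neg l_neg)
  ultimately show "\<exists>N \<in> carrier (SL2 R). N \<otimes>\<^bsub>SL2 R\<^esub> M = \<one>\<^bsub>SL2 R\<^esub>"
    by (auto simp: SL2_def)
qed

end

end

theory Submission
  imports Defs "HOL-Number_Theory.Euler_Criterion"
begin

text \<open>
  Put \<open>t = k q\<^sup>2 v\<close>. An integer matrix \<open>g\<close> with \<open>g A = B g\<close> is determined by its first row
  \<open>(a, b)\<close> and has determinant \<open>q\<^sup>2 a\<^sup>2 + t a b - v b\<^sup>2\<close>; if \<open>g A = B\<^sup>-\<^sup>1 g\<close>, the determinant
  is the negative of this form. So \<open>A\<close> is conjugate to \<open>B\<close> in a congruence quotient as soon as the
  form represents 1 there, which holds modulo \<open>q\<^sup>e\<close> because \<open>- v\<close> is a square (Hensel), and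
  modulo numbers prime to \<open>q\<close> because \<open>q\<^sup>2\<close> is a square. Over \<open>\<int>\<close> the form does not represent
  \<open>-1\<close>, by reduction modulo \<open>p\<close> or 4. With \<open>x = q a\<close> and \<open>n = k q\<close> it becomes
  \<open>x\<^sup>2 + n v x b - v b\<^sup>2\<close>; Vieta jumping reduces any representation of 1 by the latter to
  \<open>b = 0\<close>, \<open>x = \<plusminus>1\<close> and changes \<open>x\<close> only by a sign modulo \<open>q\<close>, so \<open>q\<close> never divides \<open>x\<close>.
\<close>

section \<open>The binary form\<close>

text \<open>The equation is quadratic in each variable, and the sign of \<open>x * b\<close> tells
  which variable can be replaced by the other root so that
  \<open>\<bar>x\<bar> + \<bar>b\<bar>\<close> drops.\<close>

lemma vieta_jumping_not_dvd:
  fixes q n v x b :: int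
  assumes "v > 0" "n > 0" "q dvd n" "\<not> q dvd 1"
  shows "x\<^sup>2 + n * v * x * b - v * b\<^sup>2 = 1 \<Longrightarrow> \<not> q dvd x"
proof (induction "nat (\<bar>x\<bar> + \<bar>b\<bar>)" arbitrary: x b rule: less_induct)
  case less
  note eq = less.prems
  have nv: "n * v > 0" using assms by simp
  have x0: "x \<noteq> 0"
  proof
    assume "x = 0"
    with eq have "v * b\<^sup>2 = -1" by simp
    moreover have "v * b\<^sup>2 \<ge> 0" using assms by simp
    ultimately show False by simp
  qed
  consider "b = 0" | "x * b > 0" | "x * b < 0"
    using x0 by (metis linorder_cases mult_eq_0_iff)
  then show ?case
  proof cases
    case 1
    then have "x\<^sup>2 = 1" using eq by simp
    then show ?thesis using assms by (metis dvd_mult2 power2_eq_square)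
  next
    case 2
    \<comment> \<open>The other root in \<open>b\<close>. The product \<open>b * b'\<close> is at
      most 0, while the sum \<open>n * x\<close> is nonzero with the sign of \<open>b\<close>; hence
      \<open>\<bar>b'\<bar> < \<bar>b\<bar>\<close>.\<close>
    define b' where "b' = n * x - b"
    have eq': "x\<^sup>2 + n * v * x * b' - v * b'\<^sup>2 = 1"
      using eq unfolding b'_def by (simp add: algebra_simps power2_eq_square)
    have "v * (b * (b - n * x)) = x\<^sup>2 - 1"
      using eq by (simp add: algebra_simps power2_eq_square)
    also have "\<dots> \<ge> 0"
      using x0 by (metis diff_ge_0_iff_ge int_one_le_iff_zero_less zero_less_power2)
    finally have "b * (b - n * x) \<ge> 0" using assms(1) by (simp add: zero_le_mult_iff)
    then have "\<bar>b'\<bar> < \<bar>b\<bar>"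
      using 2 assms(2) unfolding b'_def
      by (smt (verit) mult_pos_pos mult_pos_neg zero_le_mult_iff zero_less_mult_iff)
    then show ?thesis using less.hyps[OF _ eq'] by simp
  next
    case 3
    \<comment> \<open>The other root in \<open>x\<close>. Here
      \<open>x * x' = - (v * b\<^sup>2 + 1)\<close> is negative and the sum
      \<open>- (n * v * b)\<close> has the sign of \<open>x\<close>.\<close>
    define x' where "x' = - (n * v * b) - x"
    have eq': "x'\<^sup>2 + n * v * x' * b - v * b\<^sup>2 = 1"
      using eq unfolding x'_def by (simp add: algebra_simps power2_eq_square)
    have "x * (x + n * v * b) = v * b\<^sup>2 + 1"
      using eq by (simp add: algebra_simps power2_eq_square)
    also have "\<dots> > 0" using assms by (smt (verit) mult_nonneg_nonneg zero_le_power2)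
    finally have "x * (x + n * v * b) > 0" .
    moreover have "x > 0 \<Longrightarrow> n * v * b < 0" "x < 0 \<Longrightarrow> n * v * b > 0"
      using 3 nv by (auto simp: mult_less_0_iff zero_less_mult_iff)
    ultimately have "\<bar>x'\<bar> < \<bar>x\<bar>"
      using x0 unfolding x'_def by (smt (verit) zero_less_mult_iff)
    then have "\<not> q dvd x'" using less.hyps[OF _ eq'] by simp
    moreover have "q dvd n * v * b" using assms(3) by simp
    ultimately show ?thesis unfolding x'_def by (metis dvd_diff dvd_minus_iff)
  qed
qed

lemma form_not_one:
  fixes k q v a b :: int
  assumes "k \<noteq> 0" "q > 1" "v > 0"
  shows "q\<^sup>2 * a\<^sup>2 + k * q\<^sup>2 * v * a * b - v * b\<^sup>2 \<noteq> 1"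
proof
  assume eq: "q\<^sup>2 * a\<^sup>2 + k * q\<^sup>2 * v * a * b - v * b\<^sup>2 = 1"
  \<comment> \<open>Moving the sign of \<open>k\<close> into \<open>b\<close> makes the coefficient
    \<open>n = \<bar>k\<bar> * q\<close> positive, as the descent requires.\<close>
  have "(q * a)\<^sup>2 + (\<bar>k\<bar> * q) * v * (q * a) * (sgn k * b) - v * (sgn k * b)\<^sup>2 = 1"
    using eq assms(1) by (cases "k > 0") (simp_all add: power2_eq_square algebra_simps)
  from vieta_jumping_not_dvd[OF assms(3) _ _ _ this, of q] assms show False
    by simp
qed

text \<open>Otherwise \<open>v\<close> would divide \<open>(q * a)\<^sup>2 + 1\<close>, but -1 is a
  square neither modulo a prime that is 3 modulo 4 nor modulo 4.\<close>

lemma form_not_minus_one: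
  fixes k q v a b :: int
  assumes "(\<exists>p. prime p \<and> [p = 3] (mod 4) \<and> p dvd v) \<or> 4 dvd v"
  shows "q\<^sup>2 * a\<^sup>2 + k * q\<^sup>2 * v * a * b - v * b\<^sup>2 \<noteq> - 1"
proof
  assume eq: "q\<^sup>2 * a\<^sup>2 + k * q\<^sup>2 * v * a * b - v * b\<^sup>2 = - 1"
  have sq: "(q * a)\<^sup>2 + 1 = v * (b\<^sup>2 - k * q\<^sup>2 * a * b)"
    using eq by (simp add: algebra_simps power2_eq_square)
  from assms show False
  proof
    assume "\<exists>p. prime p \<and> [p = 3] (mod 4) \<and> p dvd v"
    then obtain p where p: "prime p" "[p = 3] (mod 4)" "p dvd v" by blast
    have "p > 2" using p prime_ge_2_int[of p] by (cases "p = 2") (auto simp: cong_def)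
    have "[(q * a)\<^sup>2 = -1] (mod p)"
      using sq p(3) by (simp add: cong_iff_dvd_diff)
    then have "QuadRes (int (nat p)) (-1)"
      using \<open>p > 2\<close> by (auto simp: QuadRes_def)
    moreover have "nat p > 2" "prime (nat p)" using \<open>p > 2\<close> p(1) by auto
    moreover have "\<not> [-1 = 0] (mod int (nat p))"
      using \<open>p > 2\<close> by (auto simp: cong_iff_dvd_diff zdvd_not_zless)
    ultimately have "[1 = (-1) ^ ((nat p - 1) div 2)] (mod int (nat p))"
      using euler_criterion[of "nat p" "-1"] by (simp add: Legendre_def)
    \<comment> \<open>With this exponent odd, Euler's criterion reads 1 = -1 modulo
      \<open>p\<close>.\<close>
    moreover have "odd ((nat p - 1) div 2)"
    proof -
      have "p mod 4 = 3" using p(2) by (simp add: cong_def)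
      then obtain j where "p = 4 * j + 3" by (metis mult_div_mod_eq)
      then have "nat p = 4 * nat j + 3" using \<open>p > 2\<close> by linarith
      then have "(nat p - 1) div 2 = 2 * nat j + 1" by simp
      then show ?thesis by simp
    qed
    ultimately have "p dvd 2" using \<open>p > 2\<close> by (simp add: cong_iff_dvd_diff)
    then show False using \<open>p > 2\<close> by (simp add: zdvd_not_zless)
  next
    assume "4 dvd v"
    then have "4 dvd (q * a)\<^sup>2 + 1" using sq by simp
    moreover have "\<not> 4 dvd z\<^sup>2 + 1" for z :: int
    proof (cases "even z")
      case True
      then obtain j where "z = 2 * j" by (rule evenE)
      then have "z\<^sup>2 + 1 = 4 * j\<^sup>2 + 1" by (simp add: power2_eq_square)
      then show ?thesis by presburger
    next
      case False
      then obtain j where "z = 2 * j + 1" by (rule oddE)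
      then have "z\<^sup>2 + 1 = 4 * (j\<^sup>2 + j) + 2" by (simp add: power2_eq_square algebra_simps)
      then show ?thesis by presburger
    qed
    ultimately show False by blast
  qed
qed

section \<open>Representing 1 modulo \<open>m\<close>\<close>

text \<open>Hensel lifting: the base case inverts a square root of \<open>- v\<close>, and the
  derivative \<open>- 2 * v * b\<close> is a unit modulo \<open>q\<close> at each step. The exponent
  \<open>Suc e\<close> keeps \<open>q\<close> a divisor of the modulus, which forces
  \<open>b\<close> to be a unit.\<close>

lemma neg_square_mod_prime_power:
  fixes q v :: int
  assumes q: "prime q" "odd q" and v: "\<not> q dvd v" "QuadRes q (- v)"
  shows "\<exists>b. [- v * b\<^sup>2 = 1] (mod q ^ Suc e)"
proof (induction e)
  case 0
  obtain y where y: "[y\<^sup>2 = - v] (mod q)" using v(2) by (auto simp: QuadRes_def)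
  have "\<not> q dvd y"
    using cong_dvd_iff[OF y] v(1) by (auto simp: power2_eq_square)
  then have "coprime y q" using q(1) by (simp add: coprime_commute prime_imp_coprime)
  then obtain b where "[y * b = 1] (mod q)" using cong_solve_coprime_int by blast
  then have "[(y * b)\<^sup>2 = 1\<^sup>2] (mod q)" by (rule cong_pow)
  moreover have "[y\<^sup>2 * b\<^sup>2 = - v * b\<^sup>2] (mod q)" using y by (rule cong_mult) simp
  ultimately have "[- v * b\<^sup>2 = 1] (mod q)"
    by (metis cong_sym cong_trans power_mult_distrib power_one)
  then show ?case by auto
next
  case (Suc e)
  then obtain b where b: "[- v * b\<^sup>2 = 1] (mod q ^ Suc e)" by blast
  then obtain r where r: "- v * b\<^sup>2 - 1 = q ^ Suc e * r"
    by (auto simp: cong_iff_dvd_diff)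
  have "\<not> q dvd b"
  proof
    assume "q dvd b"
    then have "q dvd - v * b\<^sup>2 - q ^ Suc e * r" by (simp add: power2_eq_square)
    moreover have "- v * b\<^sup>2 - q ^ Suc e * r = 1" using r by simp
    ultimately have "q dvd 1" by metis
    then show False using q(1) by auto
  qed
  moreover have "\<not> q dvd 2"
    using q(2) primes_dvd_imp_eq[OF q(1), of 2] by auto
  ultimately have "\<not> q dvd 2 * v * b"
    using q(1) v(1) by (auto simp: prime_dvd_mult_iff)
  then have "coprime (2 * v * b) q"
    using prime_imp_coprime[OF q(1)] coprime_commute by blast
  then obtain s0 where "[2 * v * b * s0 = 1] (mod q)" using cong_solve_coprime_int by blast
  then have "[2 * v * b * s0 * r = 1 * r] (mod q)" by (rule cong_scalar_right)
  then obtain u where u: "2 * v * b * (s0 * r) - r = q * u"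
    by (auto simp: cong_iff_dvd_diff mult.assoc)
  \<comment> \<open>Replacing \<open>b\<close> by \<open>b + s * q ^ Suc e\<close> turns the error
    \<open>r\<close> into \<open>r - 2 * v * b * s\<close> modulo \<open>q\<close>;
    \<open>s0\<close> inverts \<open>2 * v * b\<close>, so this choice cancels it.\<close>
  define s where "s = s0 * r"
  have "- v * (b + s * q ^ Suc e)\<^sup>2 - 1
      = (- v * b\<^sup>2 - 1) - 2 * v * b * s * q ^ Suc e - v * s\<^sup>2 * q ^ Suc e * q ^ Suc e"
    by (simp add: power2_eq_square algebra_simps)
  also have "\<dots> = - (q ^ Suc e) * (2 * v * b * s - r) - v * s\<^sup>2 * q ^ Suc e * q ^ Suc e"
    unfolding r by (simp add: algebra_simps)
  also have "\<dots> = q ^ Suc (Suc e) * (- u - v * s\<^sup>2 * q ^ e)"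
    using u unfolding s_def by (simp add: algebra_simps)
  finally have "q ^ Suc (Suc e) dvd - v * (b + s * q ^ Suc e)\<^sup>2 - 1"
    by (metis dvd_triv_left)
  then show ?case by (auto simp: cong_iff_dvd_diff)
qed

lemma form_one_mod:
  fixes k q v m :: int
  assumes q: "prime q" "odd q" and v: "\<not> q dvd v" "QuadRes q (- v)" and m: "m \<noteq> 0"
  shows "\<exists>a b. [q\<^sup>2 * a\<^sup>2 + k * q\<^sup>2 * v * a * b - v * b\<^sup>2 = 1] (mod m)"
proof -
  have "\<not> is_unit q" using q(1) by auto
  then obtain m' where m': "m = q ^ multiplicity q m * m'" "\<not> q dvd m'"
    using multiplicity_decompose'[of m q] m by auto
  define e where "e = multiplicity q m"
  have cop: "coprime q m'" using q(1) m'(2) by (rule prime_imp_coprime)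
  then have cop': "coprime (q ^ Suc e) m'" by simp
  obtain b0 where b0: "[- v * b0\<^sup>2 = 1] (mod q ^ Suc e)"
    using neg_square_mod_prime_power[OF q v] by blast
  obtain a0 where a0: "[q * a0 = 1] (mod m')" using cong_solve_coprime_int[OF cop] by blast
  \<comment> \<open>Modulo the power of \<open>q\<close> the form becomes
    \<open>- v * b0\<^sup>2\<close>, and modulo \<open>m'\<close> it becomes
    \<open>(q * a0)\<^sup>2\<close>; both are 1.\<close>
  obtain a where a: "[a = 0] (mod q ^ Suc e)" "[a = a0] (mod m')"
    using binary_chinese_remainder_int[OF cop'] by blast
  obtain b where b: "[b = b0] (mod q ^ Suc e)" "[b = 0] (mod m')"
    using binary_chinese_remainder_int[OF cop'] by blast
  let ?Q = "\<lambda>a b. q\<^sup>2 * a\<^sup>2 + k * q\<^sup>2 * v * a * b - v * b\<^sup>2"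
  have cong: "[?Q x y = ?Q x' y'] (mod n)" if "[x = x'] (mod n)" "[y = y'] (mod n)" for x y x' y' n
    using that by (intro cong_add cong_diff cong_mult cong_pow cong_refl)
  have "[?Q a b = 1] (mod q ^ Suc e)"
    using cong[OF a(1) b(1)] b0 by (simp add: cong_def)
  moreover have "[?Q a b = 1] (mod m')"
  proof -
    have "[(q * a0)\<^sup>2 = 1\<^sup>2] (mod m')" using a0 by (rule cong_pow)
    then show ?thesis using cong[OF a(2) b(2)] by (simp add: cong_def power_mult_distrib)
  qed
  ultimately have "[?Q a b = 1] (mod q ^ Suc e * m')"
    using cop' by (rule coprime_cong_mult)
  moreover have "m dvd q ^ Suc e * m'"
    by (subst m'(1)) (simp add: e_def[symmetric])
  ultimately show ?thesis using cong_dvd_modulus by blast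
qed

section \<open>Conjugacy\<close>

lemma vector_2_2:
  fixes a b c d :: "'a :: zero"
  defines "M \<equiv> vector [vector [a, b], vector [c, d]] :: 'a^2^2"
  shows "M $ 1 $ 1 = a" "M $ 1 $ 2 = b" "M $ 2 $ 1 = c" "M $ 2 $ 2 = d"
  by (simp_all add: M_def)

lemmas mat_2_2_simps = vec_eq_iff forall_2 matrix_matrix_mult_def sum_2 vector_2_2 det_2

section \<open>Reduction modulo \<open>m\<close>\<close>

text \<open>The entries of \<open>reduce_mod\<close> are values of \<open>ZMod m\<close>, so this
  homomorphism carries determinants and products to the quotient.\<close>

lemma ZMod_hom:
  "ZMod m \<in> ring_hom \<Z> (ZFact m)"
proof -
  have "(\<lambda>x. ZMod m x) = (+>\<^bsub>\<Z>\<^esub>) (Idl\<^bsub>\<Z>\<^esub> {m})"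
    by (simp add: fun_eq_iff ZMod_def)
  then show ?thesis
    using ideal.rcos_ring_hom[OF int.genideal_ideal[of "{m}"]] by (simp add: ZFact_def)
qed

lemma det2_reduce_mod: "det2 (ZFact m) (reduce_mod m A) = ZMod m (det A)"
proof -
  interpret Z: cring "ZFact m" by (rule ZFact_is_cring)
  interpret h: ring_hom_ring "\<Z>" "ZFact m" "ZMod m"
    by (rule ring_hom_ringI2[OF int.ring_axioms Z.ring_axioms ZMod_hom])
  have "ZMod m (x - y) = ZMod m x \<ominus>\<^bsub>ZFact m\<^esub> ZMod m y" for x y
    using h.hom_add[of x "- y"] h.hom_a_inv[of y]
    by (simp add: a_minus_def)
  moreover have "ZMod m (x * y) = ZMod m x \<otimes>\<^bsub>ZFact m\<^esub> ZMod m y" for x y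
    using h.hom_mult[of x y] by simp
  ultimately show ?thesis
    by (simp add: det2_def det_2 reduce_mod_def ZMod_def[symmetric])
qed

lemma reduce_mod_mult:
  "reduce_mod m (A ** B) = reduce_mod m A \<otimes>\<^bsub>mat2 (ZFact m)\<^esub> reduce_mod m B"
proof -
  interpret Z: cring "ZFact m" by (rule ZFact_is_cring)
  interpret h: ring_hom_ring "\<Z>" "ZFact m" "ZMod m"
    by (rule ring_hom_ringI2[OF int.ring_axioms Z.ring_axioms ZMod_hom])
  show ?thesis
    using h.hom_mult h.hom_add
    by (simp add: reduce_mod_def ZMod_def[symmetric] mat2_def matrix_matrix_mult_def sum_2)
qed

lemma reduce_mod_SL2:
  assumes "[det A = 1] (mod m)"
  shows "reduce_mod m A \<in> carrier (SL2 (ZFact m))"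
proof -
  have "ZMod m x \<in> carrier (ZFact m)" for x
    using ring_hom_closed[OF ZMod_hom] by simp
  moreover have "ZMod m (det A) = \<one>\<^bsub>ZFact m\<^esub>"
    using assms ring_hom_one[OF ZMod_hom, of m] ZMod_eq_mod[of m "det A" 1]
    by (simp add: cong_def)
  ultimately show ?thesis
    by (simp add: SL2_def mat2_def det2_reduce_mod)
      (simp add: reduce_mod_def ZMod_def[symmetric])
qed

text \<open>The integer matrix \<open>g\<close> need not be invertible; since its determinant is 1
  modulo \<open>m\<close>, the intertwining relation becomes conjugacy after reduction.\<close>

lemma conjugate_in_reduce_mod:
  assumes "g ** A = B ** g" "det A = 1" "det B = 1" "[det g = 1] (mod m)"
  shows "conjugate_in (SL2 (ZFact m)) (reduce_mod m A) (reduce_mod m B)"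
proof -
  interpret group "SL2 (ZFact m)" by (intro cring.group_SL2 ZFact_is_cring)
  have mem: "reduce_mod m A \<in> carrier (SL2 (ZFact m))"
    "reduce_mod m B \<in> carrier (SL2 (ZFact m))" "reduce_mod m g \<in> carrier (SL2 (ZFact m))"
    using assms by (simp_all add: reduce_mod_SL2)
  have "reduce_mod m g \<otimes>\<^bsub>SL2 (ZFact m)\<^esub> reduce_mod m A
      = reduce_mod m B \<otimes>\<^bsub>SL2 (ZFact m)\<^esub> reduce_mod m g"
    using arg_cong[OF assms(1), of "reduce_mod m"] by (simp add: reduce_mod_mult SL2_def)
  then show ?thesis
    unfolding conjugate_in_def using mem
    by (intro bexI[of _ "reduce_mod m g"]) (simp_all add: inv_solve_right)
qed

section \<open>Conjugacy over the integers\<close>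

lemma conjugate_in_GL2_intE:
  assumes "conjugate_in (GL2 \<Z>) A B"
  obtains g where "g ** A = B ** g" "det g = 1 \<or> det g = -1"
proof -
  interpret group "GL2 \<Z>" by (intro cring.group_GL2 int_is_cring)
  have ops: "mult (GL2 \<Z>) = (**)" "one (GL2 \<Z>) = mat 1"
    by (simp_all add: GL2_def units_of_def mat2_int)
  obtain g where g: "g \<in> carrier (GL2 \<Z>)" "B = g ** A ** inv\<^bsub>GL2 \<Z>\<^esub> g"
    using assms by (auto simp: conjugate_in_def ops)
  have inv: "inv\<^bsub>GL2 \<Z>\<^esub> g ** g = mat 1" using l_inv[OF g(1)] by (simp add: ops)
  show thesis
  proof (rule that)
    show "g ** A = B ** g"
      unfolding g(2) by (simp add: matrix_mul_assoc[symmetric] inv)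
    have "det (inv\<^bsub>GL2 \<Z>\<^esub> g) * det g = 1"
      using arg_cong[OF inv, of det] by (simp add: det_mul)
    then show "det g = 1 \<or> det g = -1"
      by (metis mult.commute pos_zmult_eq_1_iff_lemma zmult_eq_1_iff)
  qed
qed

lemma inv_GL2_int:
  assumes "C ** B = mat 1" "B ** C = mat 1"
  shows "inv\<^bsub>GL2 \<Z>\<^esub> B = C"
proof -
  interpret group "GL2 \<Z>" by (intro cring.group_GL2 int_is_cring)
  show ?thesis
  proof (rule inv_equality)
    show "B \<in> carrier (GL2 \<Z>)" "C \<in> carrier (GL2 \<Z>)"
      using assms by (auto simp: carrier_GL2_int invertible_def)
    show "C \<otimes>\<^bsub>GL2 \<Z>\<^esub> B = \<one>\<^bsub>GL2 \<Z>\<^esub>"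
      using assms by (simp add: GL2_def units_of_def mat2_int)
  qed
qed

section \<open>The explicit family\<close>

lemma good_pair_family:
  fixes k q v :: int
  assumes k: "k \<noteq> 0" and q: "prime q" "odd q" and v: "v > 0" "\<not> q dvd v" "QuadRes q (- v)"
    and p: "(\<exists>p. prime p \<and> [p = 3] (mod 4) \<and> p dvd v) \<or> 4 dvd v"
  shows "good_pair
        (vector [vector [1, k * q\<^sup>2], vector [k * v, 1 + k\<^sup>2 * q\<^sup>2 * v]])
        (vector [vector [1, k], vector [k * v * q\<^sup>2, 1 + k\<^sup>2 * q\<^sup>2 * v]])"
    (is "good_pair ?A ?B")
proof -
  let ?Q = "\<lambda>a b. q\<^sup>2 * a\<^sup>2 + k * q\<^sup>2 * v * a * b - v * b\<^sup>2"
  \<comment> \<open>The adjugate of \<open>?B\<close>, hence its inverse, as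
    \<open>det ?B = 1\<close>.\<close>
  let ?C = "vector [vector [1 + k\<^sup>2 * q\<^sup>2 * v, - k], vector [- (k * v * q\<^sup>2), 1]] :: int^2^2"
  have Q: "?Q a b \<noteq> 1" "?Q a b \<noteq> -1" for a b
    using form_not_one[of k q v a b] form_not_minus_one[OF p, of q a k b] k v(1) prime_gt_1_int[OF q(1)]
    by auto
  have det: "det ?A = 1" "det ?B = 1"
    by (simp_all add: mat_2_2_simps power2_eq_square)
  have "conjugate_in_congruence_quotients ?A ?B"
    unfolding conjugate_in_congruence_quotients_def
  proof (intro allI impI)
    fix m :: int assume "m \<noteq> 0"
    then obtain a b where ab: "[?Q a b = 1] (mod m)"
      using form_one_mod[OF q v(2,3)] by blast
    \<comment> \<open>The solution of \<open>g ** ?A = ?B ** g\<close> with first row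
      \<open>(a, b)\<close>.\<close>
    let ?g = "vector [vector [a, b], vector [b * v, a * q\<^sup>2 + k * q\<^sup>2 * v * b]] :: int^2^2"
    have "?g ** ?A = ?B ** ?g"
      by (simp add: mat_2_2_simps algebra_simps power2_eq_square)
    moreover have "det ?g = ?Q a b"
      by (simp add: mat_2_2_simps algebra_simps power2_eq_square)
    ultimately show "conjugate_in (SL2 (ZFact m)) (reduce_mod m ?A) (reduce_mod m ?B)"
      using conjugate_in_reduce_mod det ab by simp
  qed
  moreover have "\<not> conjugate_in (GL2 \<Z>) ?A ?B"
  proof
    assume "conjugate_in (GL2 \<Z>) ?A ?B"
    then obtain g where g: "g ** ?A = ?B ** g" "det g = 1 \<or> det g = -1"
      by (rule conjugate_in_GL2_intE)
    \<comment> \<open>Comparing the first rows of both sides already determines the second row of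
      \<open>g\<close>, up to the nonzero factor \<open>k\<close>.\<close>
    have e: "k * (g$2$1 - v * g$1$2) = 0"
      "k * (g$2$2 - (q\<^sup>2 * g$1$1 + k * q\<^sup>2 * v * g$1$2)) = 0"
      using g(1) by (auto simp: mat_2_2_simps algebra_simps power2_eq_square)
    then have "g$2$1 = v * g$1$2" "g$2$2 = q\<^sup>2 * g$1$1 + k * q\<^sup>2 * v * g$1$2"
      using k by simp_all
    then have "det g = ?Q (g$1$1) (g$1$2)"
      by (simp add: det_2 algebra_simps power2_eq_square)
    with g(2) Q show False by metis
  qed
  moreover have "\<not> conjugate_in (GL2 \<Z>) ?A (inv\<^bsub>GL2 \<Z>\<^esub> ?B)"
  proof
    have "inv\<^bsub>GL2 \<Z>\<^esub> ?B = ?C"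
      by (rule inv_GL2_int) (simp_all add: mat_2_2_simps mat_def algebra_simps power2_eq_square)
    moreover assume "conjugate_in (GL2 \<Z>) ?A (inv\<^bsub>GL2 \<Z>\<^esub> ?B)"
    ultimately obtain g where g: "g ** ?A = ?C ** g" "det g = 1 \<or> det g = -1"
      by (metis conjugate_in_GL2_intE)
    have e: "k * (g$2$1 - (k * q\<^sup>2 * v * g$1$1 - v * g$1$2)) = 0"
      "k * (g$2$2 + q\<^sup>2 * g$1$1) = 0"
      using g(1) by (auto simp: mat_2_2_simps algebra_simps power2_eq_square)
    then have "g$2$1 = k * q\<^sup>2 * v * g$1$1 - v * g$1$2" "g$2$2 = - (q\<^sup>2 * g$1$1)"
      using k by (simp_all add: eq_neg_iff_add_eq_0)
    then have "det g = - ?Q (g$1$1) (g$1$2)"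
      by (simp only: det_2) (simp add: algebra_simps power2_eq_square)
    with g(2) Q show False by (metis add.inverse_inverse)
  qed
  ultimately show ?thesis
    by (simp add: good_pair_def carrier_SL2_int det)
qed

theorem proposition1p3:
  shows "infinite {(A, B). good_pair A B} \<and>
    (\<forall>k q v :: int.
      k \<noteq> 0 \<and>
      prime q \<and> odd q \<and> [q = 1] (mod 4) \<and>
      v > 0 \<and> \<not> [- v = 0] (mod q) \<and> QuadRes q (- v) \<and>
      ((\<exists>p. prime p \<and> [p = 3] (mod 4) \<and> p dvd v) \<or> 4 dvd v) \<longrightarrow>
      good_pair
        (vector [vector [1, k * q\<^sup>2], vector [k * v, 1 + k\<^sup>2 * q\<^sup>2 * v]])
        (vector [vector [1, k], vector [k * v * q\<^sup>2, 1 + k\<^sup>2 * q\<^sup>2 * v]]))"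
proof
  \<comment> \<open>The family for \<open>q = 5\<close> and \<open>v = 4\<close>, where -4 = 1 is a
    square modulo 5. It is injective because \<open>k\<close> is the upper right entry of the second
    matrix.\<close>
  define F :: "int \<Rightarrow> (int^2^2) \<times> (int^2^2)" where
    "F k = (vector [vector [1, k * 5\<^sup>2], vector [k * 4, 1 + k\<^sup>2 * 5\<^sup>2 * 4]],
      vector [vector [1, k], vector [k * 4 * 5\<^sup>2, 1 + k\<^sup>2 * 5\<^sup>2 * 4]])" for k
  have "QuadRes 5 (- 4)"
    unfolding QuadRes_def by (intro exI[of _ 1]) (simp add: cong_def)
  moreover have "prime (5 :: int)" by simp
  ultimately have "F ` {0<..} \<subseteq> {(A, B). good_pair A B}"
    using good_pair_family[of _ 5 4] by (auto simp: F_def)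
  moreover have "inj_on F {0<..}"
    by (rule inj_onI) (simp add: F_def mat_2_2_simps)
  ultimately show "infinite {(A, B). good_pair A B}"
    using infinite_Ioi[of "0 :: int"] by (meson finite_imageD finite_subset)
qed (auto intro!: good_pair_family simp: cong_0_iff)

end
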